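(* Let $a>0$. For each $n\ge2$ let $X^{(n)}$ be the simple random walk on the complete graph with $n$ vertices, i.e. with vertex set $V^{(n)}$, $\sharp V^{(n)}=n$, and $p^{(n)}(x,y)=\frac{1}{n-1}1_{x\ne y}$, and let $c^{(n)}>0$ satisfy $c^{(n)}=n^{-a+o(1)}$ as $n\to\infty$. Let $\mu^{(n)}$ and $\bar\mu^{(n)}$ be the associated loop measure and normalized loop measure (defined in the context). Then $$\lim_{n\to\infty}\frac{\|\mu^{(n)}\|}{\log n}=a,$$ where $\|\mu^{(n)}\|$ is the total mass of $\mu^{(n)}$, and as $n\to\infty$ the law of $\log|\ell|/\log n$ under $\bar\mu^{(n)}$ converges weakly to the uniform distribution on $(0,a)$, i.e. to $1_{0<x<a}\cdot\frac1a\,\mathrm{d}x$.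
   Context: A based loop on $V^{(n)}$ is an element $\dot\ell=(x_1,\ldots,x_k)\in (V^{(n)})^k$, $k\ge1$; its length is $|\dot\ell|=k$. Two based loops are equivalent if they coincide up to a circular permutation, and a loop $\ell$ is an equivalence class of based loops; its length $|\ell|$ is the common length of its representatives. The based loop measure $\dot\mu^{(n)}$ gives the based loop $\dot\ell=(x_1,\ldots,x_k)$ the mass $$\dot\mu^{(n)}(\dot\ell)=\frac1k(1+c^{(n)})^{-k}\,p^{(n)}(x_1,x_2)p^{(n)}(x_2,x_3)\cdots p^{(n)}(x_k,x_1)$$ (for $k=1$ the product is $p^{(n)}(x_1,x_1)$). The loop measure $\mu^{(n)}$ is the push-forward of $\dot\mu^{(n)}$ to the space of loops, $\|\mu^{(n)}\|$ is its (finite) total mass, and $\bar\mu^{(n)}=\mu^{(n)}/\|\mu^{(n)}\|$ is the normalized probability measure. *)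

theory Defs
  imports "HOL-Probability.Probability" "HOL-Library.Landau_Symbols"
begin

definition based_loops :: "'v set \<Rightarrow> 'v list set" where
  "based_loops V = {xs. xs \<noteq> [] \<and> set xs \<subseteq> V}"

definition circ_perm :: "'v set \<Rightarrow> ('v list \<times> 'v list) set" where
  "circ_perm V = {(xs, ys). xs \<in> based_loops V \<and> ys \<in> based_loops V \<and> (\<exists>m. ys = rotate m xs)}"

text \<open>A loop is an equivalence class, i.e. the set of all its based representatives.\<close>

definition loops :: "'v set \<Rightarrow> 'v list set set" where
  "loops V = based_loops V // circ_perm V"

text \<open>All representatives of a loop have the same length, so the image below is a singleton.\<close>

definition loop_length :: "'v list set \<Rightarrow> nat" where
  "loop_length l = the_elem (length ` l)"

text \<open>The index is reduced modulo the length so that the product closes up with the factor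
  from the last vertex to the first one; for length 1 it is \<open>p x x\<close>.\<close>

definition based_loop_weight :: "('v \<Rightarrow> 'v \<Rightarrow> real) \<Rightarrow> real \<Rightarrow> 'v list \<Rightarrow> real" where
  "based_loop_weight p c xs =
     1 / real (length xs) * (1 + c) powi (- int (length xs)) *
     (\<Prod>i<length xs. p (xs ! i) (xs ! (Suc i mod length xs)))"

definition based_loop_measure :: "'v set \<Rightarrow> ('v \<Rightarrow> 'v \<Rightarrow> real) \<Rightarrow> real \<Rightarrow> 'v list measure" where
  "based_loop_measure V p c =
     point_measure (based_loops V) (\<lambda>xs. ennreal (based_loop_weight p c xs))"

definition loop_measure :: "'v set \<Rightarrow> ('v \<Rightarrow> 'v \<Rightarrow> real) \<Rightarrow> real \<Rightarrow> 'v list set measure" where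
  "loop_measure V p c =
     distr (based_loop_measure V p c) (count_space (loops V)) (\<lambda>xs. circ_perm V `` {xs})"

definition normalized_loop_measure ::
    "'v set \<Rightarrow> ('v \<Rightarrow> 'v \<Rightarrow> real) \<Rightarrow> real \<Rightarrow> 'v list set measure" where
  "normalized_loop_measure V p c =
     scale_measure (inverse (emeasure (loop_measure V p c) (space (loop_measure V p c))))
       (loop_measure V p c)"

definition complete_graph_walk :: "'v set \<Rightarrow> 'v \<Rightarrow> 'v \<Rightarrow> real" where
  "complete_graph_walk V x y = (if x \<noteq> y then 1 / (real (card V) - 1) else 0)"

end

theory Submission
  imports Defs
begin

text \<open>
  The loops of length \<open>k\<close> together have mass \<open>q ^ k / k\<close> times the trace
  of the \<open>k\<close>-th power of the transition matrix, where \<open>q = 1 / (1 + c)\<close>.  That matrix has the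
  eigenvalue 1 once and the eigenvalue \<open>- 1 / (n - 1)\<close> with multiplicity \<open>n - 1\<close>, so the trace is
  \<open>1 + (n - 1) (- 1 / (n - 1)) ^ k\<close>.  The contribution of the small eigenvalues to the mass of any set of
  lengths is at most 4, uniformly in \<open>n \<ge> 3\<close> and \<open>c\<close>, hence invisible after division by
  \<open>ln n\<close> (\<open>length_set_mass_approx\<close>).  What remains is the logarithmic series \<open>q ^ k / k\<close>: it behaves like the
  harmonic series as long as \<open>k\<close> is small compared with \<open>1 / c\<close>, which is \<open>n powr a\<close> up to a
  factor \<open>n powr o(1)\<close>, and it is cut off beyond.  The harmonic series gives the mass
  \<open>x ln n\<close> to the lengths up to \<open>n powr x\<close>: the length is uniform on the logarithmic scale.

  The cut-off needs no separate tail estimate.  The whole series sums to \<open>ln (1 + 1 / c)\<close>, which is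
  asymptotic to \<open>a ln n\<close>, and by the lower bound for the truncated series the lengths up to
  \<open>n powr y\<close> already account for \<open>y ln n\<close> of it, for every \<open>y < a\<close>.  Monotonicity in the set
  of lengths then squeezes the mass of every set that contains all these lengths
  (\<open>length_set_mass_tendsto\<close>).  This one argument yields the total mass, and the mass of the lengths up to
  \<open>n powr x\<close> on both sides of the cut-off; their quotient is the distribution function.
\<close>

section \<open>Closed walks on the complete graph\<close>

fun walk_weight :: "('v \<Rightarrow> 'v \<Rightarrow> real) \<Rightarrow> 'v \<Rightarrow> 'v list \<Rightarrow> 'v \<Rightarrow> real" where
  "walk_weight p x [] y = p x y"
| "walk_weight p x (z # zs) y = p x z * walk_weight p z zs y"

text \<open>The cyclic product of a based loop is the weight of a closed walk, and a walk, unlike a cyclic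
  product, can be shortened by one step: this makes the trace accessible to induction.\<close>

lemma walk_weight_eq_prod:
  "walk_weight p x zs y = (\<Prod>i<Suc (length zs). p ((x # zs) ! i) ((zs @ [y]) ! i))"
proof (induction zs arbitrary: x)
  case (Cons z zs)
  show ?case
    by (subst prod.lessThan_Suc_shift) (simp add: Cons.IH del: prod.lessThan_Suc)
qed simp

lemma cyclic_prod_eq_walk_weight:
  "(\<Prod>i<length (x # zs). p ((x # zs) ! i) ((x # zs) ! (Suc i mod length (x # zs))))
     = walk_weight p x zs x"
proof -
  have "(x # zs) ! (Suc i mod length (x # zs)) = (zs @ [x]) ! i" if "i < length (x # zs)" for i
  proof (cases "i = length zs")
    case False
    with that have "i < length zs" by simp
    then show ?thesis by (simp add: nth_append)
  qed (simp add: nth_append)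
  then show ?thesis
    unfolding walk_weight_eq_prod by (intro prod.cong) auto
qed

lemma sum_lists_length_Suc:
  fixes f :: "'v list \<Rightarrow> real"
  shows "(\<Sum>xs | set xs \<subseteq> V \<and> length xs = Suc m. f xs)
       = (\<Sum>x\<in>V. \<Sum>zs | set zs \<subseteq> V \<and> length zs = m. f (x # zs))"
proof -
  let ?L = "{zs. set zs \<subseteq> V \<and> length zs = m}"
  have "(\<Sum>xs | set xs \<subseteq> V \<and> length xs = Suc m. f xs) = (\<Sum>(x, zs)\<in>V \<times> ?L. f (x # zs))"
    by (rule sum.reindex_bij_witness[where i = "\<lambda>(x, zs). x # zs" and j = "\<lambda>xs. (hd xs, tl xs)"])
       (auto simp: length_Suc_conv)
  then show ?thesis
    by (simp add: sum.cartesian_product)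
qed

text \<open>The entry at \<open>x\<close>, \<open>y\<close> of the power \<open>Suc m\<close> of the transition matrix.  That matrix is
  \<open>E - (I - E) / (n - 1)\<close> with the orthogonal projection \<open>E\<close> onto the constant functions, all entries
  of which are \<open>1 / n\<close>.\<close>

lemma sum_walk_weight_complete_graph:
  assumes V: "finite V" "card V = n" "n \<ge> 2" and xy: "x \<in> V" "y \<in> V"
  shows "(\<Sum>zs | set zs \<subseteq> V \<and> length zs = m. walk_weight (complete_graph_walk V) x zs y)
       = 1 / real n + (of_bool (x = y) - 1 / real n) * (- 1 / (real n - 1)) ^ Suc m"
  using xy(1)
proof (induction m arbitrary: x)
  case 0
  have "{zs. set zs \<subseteq> V \<and> length zs = 0} = {[]}" by auto
  then show ?case
    using V by (auto simp: complete_graph_walk_def field_simps)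
next
  case (Suc m)
  let ?p = "complete_graph_walk V" and ?r = "- 1 / (real n - 1)"
  have np: "real n > 1" using V(3) by simp
  have row: "(\<Sum>z\<in>V. ?p x z * g z) = (sum g V - g x) / (real n - 1)" for g :: "'a \<Rightarrow> real"
  proof -
    have "(\<Sum>z\<in>V. ?p x z * g z) = (\<Sum>z\<in>V - {x}. g z / (real n - 1))"
      using V Suc.prems by (intro sum.mono_neutral_cong_right) (auto simp: complete_graph_walk_def)
    also have "\<dots> = (sum g V - g x) / (real n - 1)"
      using V Suc.prems by (simp add: sum_divide_distrib[symmetric] sum_diff1)
    finally show ?thesis .
  qed
  have sum1: "(\<Sum>z\<in>V. of_bool (z = y) :: real) = 1"
    using V(1) xy(2) by (simp add: of_bool_def)
  have "(\<Sum>zs | set zs \<subseteq> V \<and> length zs = Suc m. walk_weight ?p x zs y)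
      = (\<Sum>z\<in>V. ?p x z * (1 / real n + (of_bool (z = y) - 1 / real n) * ?r ^ Suc m))"
    by (simp add: sum_lists_length_Suc sum_distrib_left[symmetric] Suc.IH)
  also have "\<dots> = ((\<Sum>z\<in>V. 1 / real n + (of_bool (z = y) - 1 / real n) * ?r ^ Suc m)
                  - (1 / real n + (of_bool (x = y) - 1 / real n) * ?r ^ Suc m)) / (real n - 1)"
    by (rule row)
  \<comment> \<open>The columns of a power of this symmetric stochastic matrix sum to 1.\<close>
  also have "(\<Sum>z\<in>V. 1 / real n + (of_bool (z = y) - 1 / real n) * ?r ^ Suc m) = 1"
    using np V(2) sum1
    by (simp add: sum.distrib sum_distrib_right[symmetric] sum_subtractf del: power_Suc of_bool_eq)
  also have "(1 - (1 / real n + (of_bool (x = y) - 1 / real n) * ?r ^ Suc m)) / (real n - 1)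
      = 1 / real n + (of_bool (x = y) - 1 / real n) * ?r ^ Suc (Suc m)"
  proof -
    have "(1 - 1 / real n) / (real n - 1) = 1 / real n" using np by (simp add: field_simps)
    moreover have "?r ^ Suc (Suc m) = - (?r ^ Suc m) / (real n - 1)" by simp
    ultimately show ?thesis
      by (smt (verit) diff_divide_distrib minus_divide_left mult_minus_right times_divide_eq_right)
  qed
  finally show ?case .
qed

lemma sum_closed_walks_complete_graph:
  assumes "finite V" "card V = n" "n \<ge> 2"
  shows "(\<Sum>xs | set xs \<subseteq> V \<and> length xs = Suc m.
            \<Prod>i<length xs. complete_graph_walk V (xs ! i) (xs ! (Suc i mod length xs)))
       = 1 + (real n - 1) * (- 1 / (real n - 1)) ^ Suc m"
proof -
  let ?p = "complete_graph_walk V"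
  have "(\<Sum>xs | set xs \<subseteq> V \<and> length xs = Suc m.
            \<Prod>i<length xs. ?p (xs ! i) (xs ! (Suc i mod length xs)))
      = (\<Sum>x\<in>V. \<Sum>zs | set zs \<subseteq> V \<and> length zs = m. walk_weight ?p x zs x)"
    by (simp only: sum_lists_length_Suc cyclic_prod_eq_walk_weight)
  also have "\<dots> = (\<Sum>x\<in>V. 1 / real n + (1 - 1 / real n) * (- 1 / (real n - 1)) ^ Suc m)"
    using assms by (intro sum.cong) (simp_all only: sum_walk_weight_complete_graph, simp)
  also have "\<dots> = 1 + (real n - 1) * (- 1 / (real n - 1)) ^ Suc m"
    using assms by (simp add: field_simps)
  finally show ?thesis .
qed

section \<open>The law of the loop length\<close>

text \<open>The mass of the loops of length \<open>k\<close>.  Division by zero makes it vanish at \<open>k = 0\<close>, which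
  agrees with the absence of loops of length 0, so that sums may run over all natural numbers.\<close>

definition length_mass :: "nat \<Rightarrow> real \<Rightarrow> nat \<Rightarrow> real" where
  "length_mass n c k = (1 / (1 + c)) ^ k / real k * (1 + (real n - 1) * (- 1 / (real n - 1)) ^ k)"

lemma based_loop_weight_nonneg:
  assumes "finite V" "card V = n" "n \<ge> 2" "c > 0"
  shows "based_loop_weight (complete_graph_walk V) c xs \<ge> 0"
  unfolding based_loop_weight_def
  using assms by (intro mult_nonneg_nonneg prod_nonneg) (auto simp: complete_graph_walk_def)

lemma sum_based_loop_weight:
  assumes "finite V" "card V = n" "n \<ge> 2"
  shows "(\<Sum>xs | xs \<in> based_loops V \<and> length xs = k. based_loop_weight (complete_graph_walk V) c xs)
       = length_mass n c k"
proof (cases k)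
  case 0
  then have empty: "{xs \<in> based_loops V. length xs = k} = {}" by (auto simp: based_loops_def)
  show ?thesis unfolding empty by (simp add: length_mass_def 0)
next
  case (Suc m)
  have eq: "{xs. xs \<in> based_loops V \<and> length xs = k} = {xs. set xs \<subseteq> V \<and> length xs = Suc m}"
    using Suc by (auto simp: based_loops_def)
  have "(\<Sum>xs | xs \<in> based_loops V \<and> length xs = k. based_loop_weight (complete_graph_walk V) c xs)
      = (\<Sum>xs | set xs \<subseteq> V \<and> length xs = Suc m. 1 / real k * (1 + c) powi (- int k) *
          (\<Prod>i<length xs. complete_graph_walk V (xs ! i) (xs ! (Suc i mod length xs))))"
    unfolding eq based_loop_weight_def using Suc by (intro sum.cong) auto
  also have "\<dots> = 1 / real k * (1 + c) powi (- int k)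
                    * (1 + (real n - 1) * (- 1 / (real n - 1)) ^ Suc m)"
    by (simp only: sum_distrib_left[symmetric] sum_closed_walks_complete_graph[OF assms])
  finally show ?thesis
    using Suc by (simp add: length_mass_def power_int_minus power_one_over field_simps
        del: of_nat_Suc power_Suc)
qed

text \<open>The sign is read off from the probabilistic meaning on the vertex set \<open>{..<n}\<close>; for odd
  \<open>k\<close> it is not apparent from the formula.\<close>

lemma length_mass_nonneg:
  assumes "n \<ge> 2" "c > 0"
  shows "length_mass n c k \<ge> 0"
  using sum_based_loop_weight[where V = "{..<n}" and n = n and k = k and c = c] assms
  by (metis based_loop_weight_nonneg card_lessThan finite_lessThan sum_nonneg)

lemma emeasure_based_loops_of_length:
  assumes "finite V" "card V = n" "n \<ge> 2" "c > 0"
  shows "emeasure (based_loop_measure V (complete_graph_walk V) c)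
           {xs \<in> based_loops V. length xs = k} = ennreal (length_mass n c k)"
proof -
  have "finite {xs \<in> based_loops V. length xs = k}"
    by (rule finite_subset[OF _ finite_lists_length_eq[OF assms(1), of k]])
       (auto simp: based_loops_def)
  then have "emeasure (based_loop_measure V (complete_graph_walk V) c) {xs \<in> based_loops V. length xs = k}
      = (\<Sum>xs | xs \<in> based_loops V \<and> length xs = k.
           ennreal (based_loop_weight (complete_graph_walk V) c xs))"
    unfolding based_loop_measure_def by (intro emeasure_point_measure_finite2) auto
  also have "\<dots> = ennreal (length_mass n c k)"
    using assms by (simp add: based_loop_weight_nonneg sum_based_loop_weight)
  finally show ?thesis .
qed

lemma loop_length_class:
  assumes "xs \<in> based_loops V"
  shows "loop_length (circ_perm V `` {xs}) = length xs"
proof -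
  have "length ` (circ_perm V `` {xs}) = {length xs}"
    using assms by (auto simp: circ_perm_def image_iff intro!: exI[of _ xs] exI[of _ 0])
  then show ?thesis by (simp add: loop_length_def)
qed

text \<open>The length is constant on each class, so the class map does not change its law, and the
  countably many finite sets of based loops of a given length can be summed.\<close>

lemma emeasure_loops_of_length_in:
  assumes "finite V" "card V = n" "n \<ge> 2" "c > 0"
  shows "emeasure (loop_measure V (complete_graph_walk V) c) {l \<in> loops V. loop_length l \<in> J}
       = (\<Sum>k. ennreal (length_mass n c k * indicator J k))"
proof -
  let ?M = "based_loop_measure V (complete_graph_walk V) c"
  let ?A = "\<lambda>k. if k \<in> J then {xs \<in> based_loops V. length xs = k} else {}"
  have sets: "sets ?M = Pow (based_loops V)" "space ?M = based_loops V"
    by (simp_all add: based_loop_measure_def sets_point_measure space_point_measure)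
  have class_in: "circ_perm V `` {xs} \<in> loops V" if "xs \<in> based_loops V" for xs
    using that by (simp add: loops_def quotientI)
  have meas: "(\<lambda>xs. circ_perm V `` {xs}) \<in> measurable ?M (count_space (loops V))"
    using class_in by (auto simp: measurable_def sets)
  have "emeasure (loop_measure V (complete_graph_walk V) c) {l \<in> loops V. loop_length l \<in> J}
      = emeasure ?M ((\<lambda>xs. circ_perm V `` {xs}) -` {l \<in> loops V. loop_length l \<in> J} \<inter> space ?M)"
    unfolding loop_measure_def by (intro emeasure_distr meas) auto
  also have "(\<lambda>xs. circ_perm V `` {xs}) -` {l \<in> loops V. loop_length l \<in> J} \<inter> space ?M = (\<Union>k. ?A k)"
    using class_in by (auto simp: sets loop_length_class split: if_splits)
  also have "emeasure ?M (\<Union>k. ?A k) = (\<Sum>k. emeasure ?M (?A k))"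
    by (intro suminf_emeasure[symmetric]) (auto simp: sets disjoint_family_on_def)
  also have "\<dots> = (\<Sum>k. ennreal (length_mass n c k * indicator J k))"
    by (intro suminf_cong) (auto simp: emeasure_based_loops_of_length[OF assms])
  finally show ?thesis .
qed

section \<open>Logarithmic sums\<close>

text \<open>This is the expansion of \<open>- ln (1 - q)\<close> at \<open>q = 1 / (1 + c)\<close>.\<close>

lemma log_series_sums:
  fixes c :: real
  assumes "c > 0"
  shows "(\<lambda>k. (1 / (1 + c)) ^ k / real k) sums ln (1 + 1 / c)"
proof -
  define q where "q = 1 / (1 + c)"
  have q: "0 < q" "q < 1" using assms by (auto simp: q_def)
  have "(\<lambda>k. - (q ^ k / real k)) sums ln (1 - q)"
    using ln_series'[of "-q"] q by (simp add: power_mult_distrib[symmetric])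
  then have "(\<lambda>k. q ^ k / real k) sums (- ln (1 - q))"
    using sums_minus by fastforce
  moreover have "- ln (1 - q) = ln (1 + 1 / c)"
  proof -
    have "1 + 1 / c = inverse (1 - q)" using assms by (simp add: q_def field_simps)
    then show ?thesis using q by (simp add: ln_inverse)
  qed
  ultimately show ?thesis by (simp add: q_def)
qed

text \<open>The factor \<open>n - 1\<close> cancels one factor of the \<open>k\<close>-th power of the small eigenvalue, and for
  \<open>n \<ge> 3\<close> the others are at most \<open>1 / 2\<close> in absolute value.  At \<open>n = 2\<close> the small eigenvalue
  is \<open>- 1\<close> and there is no geometric decay.\<close>

lemma length_mass_approx:
  assumes "n \<ge> 3" "c > 0"
  shows "\<bar>length_mass n c k - (1 / (1 + c)) ^ k / real k\<bar> \<le> 2 * (1 / 2) ^ k"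
proof (cases k)
  case (Suc m)
  define q where "q = 1 / (1 + c)"
  have q: "0 < q" "q < 1" using assms by (auto simp: q_def)
  define r where "r = 1 / (real n - 1)"
  have r: "0 < r" "r \<le> 1 / 2" "(real n - 1) * r = 1" using assms by (auto simp: r_def)
  have "length_mass n c k - q ^ k / real k = q ^ k / real k * ((real n - 1) * (- r) ^ k)"
    by (simp add: length_mass_def q_def r_def algebra_simps)
  also have "(real n - 1) * (- r) ^ k = - ((- r) ^ m)"
  proof -
    have "(real n - 1) * (- r) ^ k = - ((real n - 1) * r) * (- r) ^ m" by (simp add: Suc)
    then show ?thesis by (simp only: r(3))
  qed
  finally have "\<bar>length_mass n c k - q ^ k / real k\<bar> = q ^ k / real k * r ^ m"
    using q r by (simp add: abs_mult power_abs)
  also have "\<dots> \<le> 1 * (1 / 2) ^ m"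
  proof (intro mult_mono power_mono)
    have "q ^ k \<le> 1" using q by (simp add: power_le_one)
    then show "q ^ k / real k \<le> 1" using Suc by (simp add: divide_le_eq)
  qed (use q r in auto)
  finally show ?thesis by (simp add: q_def Suc)
qed (simp add: length_mass_def)

definition length_set_mass :: "nat \<Rightarrow> real \<Rightarrow> nat set \<Rightarrow> real" where
  "length_set_mass n c J = (\<Sum>k. length_mass n c k * indicator J k)"

text \<open>The part of \<open>length_set_mass\<close> that comes from the eigenvalue 1.\<close>

definition log_set_sum :: "real \<Rightarrow> nat set \<Rightarrow> real" where
  "log_set_sum c J = (\<Sum>k. (1 / (1 + c)) ^ k / real k * indicator J k)"

lemma summable_log_set:
  assumes "c > 0"
  shows "summable (\<lambda>k. (1 / (1 + c)) ^ k / real k * indicator J k)"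
  using sums_summable[OF log_series_sums[OF assms]]
  by (rule summable_comparison_test'[where N = 0]) (use assms in \<open>auto simp: indicator_def\<close>)

lemma summable_length_set:
  assumes "n \<ge> 3" "c > 0"
  shows "summable (\<lambda>k. length_mass n c k * indicator J k)"
proof (rule summable_comparison_test'[where N = 0])
  show "summable (\<lambda>k. (1 / (1 + c)) ^ k / real k + 2 * (1 / 2) ^ k)"
    using sums_summable[OF log_series_sums[OF assms(2)]]
    by (intro summable_add summable_mult summable_geometric) auto
  fix k
  show "norm (length_mass n c k * indicator J k) \<le> (1 / (1 + c)) ^ k / real k + 2 * (1 / 2) ^ k"
    using length_mass_approx[OF assms, of k] length_mass_nonneg[of n c k] assms
    by (auto simp: indicator_def)
qed

lemma length_set_mass_approx:
  assumes "n \<ge> 3" "c > 0"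
  shows "\<bar>length_set_mass n c J - log_set_sum c J\<bar> \<le> 4"
proof -
  have geo: "(\<lambda>k. 2 * (1 / 2) ^ k) sums (4 :: real)"
    using sums_mult[OF geometric_sums[of "1 / 2 :: real"], of 2] by simp
  let ?d = "\<lambda>k. length_mass n c k * indicator J k - (1 / (1 + c)) ^ k / real k * indicator J k"
  have le: "\<bar>?d k\<bar> \<le> 2 * (1 / 2) ^ k" for k
    using length_mass_approx[OF assms, of k] by (auto simp: indicator_def)
  have "length_set_mass n c J - log_set_sum c J = suminf ?d"
    unfolding length_set_mass_def log_set_sum_def
    by (intro suminf_diff summable_length_set summable_log_set assms)
  moreover have "norm (suminf ?d) \<le> (\<Sum>k. 2 * (1 / 2) ^ k)"
    using le by (intro norm_suminf_le sums_summable[OF geo]) auto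
  ultimately show ?thesis using sums_unique[OF geo] by simp
qed

lemma length_set_mass_mono:
  assumes "n \<ge> 3" "c > 0" "I \<subseteq> J"
  shows "length_set_mass n c I \<le> length_set_mass n c J"
  unfolding length_set_mass_def
  using assms(3) length_mass_nonneg[of n c] assms
  by (intro suminf_le summable_length_set assms) (auto simp: indicator_def)

lemma length_set_mass_nonneg:
  assumes "n \<ge> 3" "c > 0"
  shows "0 \<le> length_set_mass n c J"
  unfolding length_set_mass_def
  using length_mass_nonneg[of n c] assms by (intro suminf_nonneg summable_length_set) auto

lemma log_set_sum_le:
  assumes "c > 0"
  shows "log_set_sum c J \<le> ln (1 + 1 / c)"
  unfolding log_set_sum_def sums_unique[OF log_series_sums[OF assms]]
  using assms sums_summable[OF log_series_sums[OF assms]]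
  by (intro suminf_le summable_log_set) (auto simp: indicator_def)

lemma log_set_sum_atMost:
  "log_set_sum c {..K} = (\<Sum>k=1..K. (1 / (1 + c)) ^ k / real k)"
proof -
  have "log_set_sum c {..K} = (\<Sum>k=1..K. (1 / (1 + c)) ^ k / real k * indicator {..K} k)"
    unfolding log_set_sum_def by (rule suminf_finite) (auto simp: indicator_def not_le)
  then show ?thesis by simp
qed

lemma log_set_sum_atMost_le:
  assumes "c > 0" "K \<ge> 1"
  shows "log_set_sum c {..K} \<le> 1 + ln (real K)"
proof -
  have "log_set_sum c {..K} \<le> harm K"
    unfolding log_set_sum_atMost harm_def
  proof (intro sum_mono)
    fix k :: nat
    have "(1 / (1 + c)) ^ k \<le> 1" using assms(1) by (intro power_le_one) auto
    from divide_right_mono[OF this, of "real k"]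
    show "(1 / (1 + c)) ^ k / real k \<le> inverse (of_nat k)"
      by (simp add: inverse_eq_divide)
  qed
  also have "\<dots> \<le> 1 + ln (real K)"
    using euler_mascheroni_sequence_decreasing[of 1 K] assms by (simp add: harm_expand)
  finally show ?thesis .
qed

text \<open>By Bernoulli's inequality each term loses at most \<open>c\<close> against the harmonic series, so the bound is
  sharp up to a constant as long as \<open>K\<close> is at most of order \<open>1 / c\<close>.\<close>

lemma log_set_sum_atMost_ge:
  assumes "c > 0"
  shows "ln (real K + 1) - c * real K \<le> log_set_sum c {..K}"
proof -
  have bern: "1 - real k * c \<le> (1 / (1 + c)) ^ k" for k
  proof (cases "c \<le> 1")
    case True
    have "1 - real k * c \<le> (1 - c) ^ k"
      using Bernoulli_inequality[of "-c" k] True by simp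
    also have "\<dots> \<le> (1 / (1 + c)) ^ k"
      using True assms by (intro power_mono) (auto simp: field_simps)
    finally show ?thesis .
  next
    case False
    show ?thesis
    proof (cases k)
      case (Suc m)
      then have "real k * c \<ge> 1 * 1" using False by (intro mult_mono) auto
      moreover have "(1 / (1 + c)) ^ k \<ge> 0" using assms by simp
      ultimately show ?thesis by linarith
    qed simp
  qed
  have "ln (real K + 1) - c * real K \<le> harm K - c * real K"
    using ln_le_harm[of K] by (simp add: add.commute)
  also have "\<dots> = (\<Sum>k=1..K. inverse (real k) - c)"
    by (simp add: harm_def sum_subtractf)
  also have "\<dots> \<le> (\<Sum>k=1..K. (1 / (1 + c)) ^ k / real k)"
  proof (intro sum_mono)
    fix k assume "k \<in> {1..K}"
    then have "inverse (real k) - c = (1 - real k * c) / real k" by (simp add: field_simps)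
    also have "\<dots> \<le> (1 / (1 + c)) ^ k / real k"
      by (intro divide_right_mono bern) simp
    finally show "inverse (real k) - c \<le> (1 / (1 + c)) ^ k / real k" .
  qed
  finally show ?thesis by (simp add: log_set_sum_atMost)
qed

section \<open>Masses on the logarithmic scale\<close>

text \<open>Since \<open>ln 0 = 0\<close>, the number 0 belongs to this set for \<open>x \<ge> 0\<close>; it carries no mass.\<close>

definition short_lengths :: "nat \<Rightarrow> real \<Rightarrow> nat set" where
  "short_lengths n x = {k. ln (real k) / ln (real n) \<le> x}"

lemma short_lengths_eq_atMost:
  assumes "n \<ge> 2" "x \<ge> 0"
  shows "short_lengths n x = {..nat \<lfloor>real n powr x\<rfloor>}"
proof -
  have "ln (real k) / ln (real n) \<le> x \<longleftrightarrow> real k \<le> real n powr x" for k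
  proof (cases "k = 0")
    case False
    have "ln (real k) / ln (real n) \<le> x \<longleftrightarrow> ln (real k) \<le> ln (real n powr x)"
      using assms by (simp add: divide_le_eq ln_powr)
    also have "\<dots> \<longleftrightarrow> real k \<le> real n powr x"
      using assms False by (subst ln_le_cancel_iff) auto
    finally show ?thesis .
  qed (use assms in simp)
  moreover have "real k \<le> real n powr x \<longleftrightarrow> k \<le> nat \<lfloor>real n powr x\<rfloor>" for k
    using powr_ge_zero[of "real n" x] by linarith
  ultimately show ?thesis
    by (simp add: short_lengths_def atMost_def)
qed

lemma length_set_mass_short_le:
  assumes "n \<ge> 3" "c > 0" "x \<ge> 0"
  shows "length_set_mass n c (short_lengths n x) \<le> x * ln (real n) + 5"
proof -
  define K where "K = nat \<lfloor>real n powr x\<rfloor>"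
  have "real n powr x \<ge> 1" using assms by (simp add: ge_one_powr_ge_zero)
  then have K: "K \<ge> 1" "real K \<le> real n powr x" by (simp_all add: K_def le_nat_floor)
  have "ln (real K) \<le> ln (real n powr x)" using K assms by (subst ln_le_cancel_iff) auto
  also have "\<dots> = x * ln (real n)" using assms by (simp add: ln_powr)
  finally have "log_set_sum c {..K} \<le> 1 + x * ln (real n)"
    using log_set_sum_atMost_le[OF assms(2) K(1)] by simp
  moreover have "short_lengths n x = {..K}"
    using assms by (simp add: K_def short_lengths_eq_atMost)
  ultimately show ?thesis
    using length_set_mass_approx[OF assms(1,2), of "{..K}"] by simp
qed

lemma length_set_mass_short_ge:
  assumes "n \<ge> 3" "c > 0" "y \<ge> 0"
  shows "y * ln (real n) - c * real n powr y - 4 \<le> length_set_mass n c (short_lengths n y)"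
proof -
  define K where "K = nat \<lfloor>real n powr y\<rfloor>"
  have K: "real K \<le> real n powr y" "real n powr y \<le> real K + 1"
    using powr_ge_zero[of "real n" y] unfolding K_def by linarith+
  have "y * ln (real n) = ln (real n powr y)" using assms by (simp add: ln_powr)
  also have "\<dots> \<le> ln (real K + 1)" using K assms by (subst ln_le_cancel_iff) auto
  finally have "y * ln (real n) - c * real n powr y \<le> ln (real K + 1) - c * real K"
    using mult_left_mono[OF K(1), of c] assms(2) by linarith
  also have "\<dots> \<le> log_set_sum c {..K}" by (rule log_set_sum_atMost_ge[OF assms(2)])
  finally show ?thesis
    using length_set_mass_approx[OF assms(1,2), of "{..K}"] assms
    by (simp add: K_def short_lengths_eq_atMost)
qed

lemma emeasure_loops_eq_length_set_mass:
  assumes "finite V" "card V = n" "n \<ge> 3" "c > 0"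
  shows "emeasure (loop_measure V (complete_graph_walk V) c) {l \<in> loops V. loop_length l \<in> J}
       = ennreal (length_set_mass n c J)"
proof -
  have "n \<ge> 2" using assms(3) by simp
  have "(\<Sum>k. ennreal (length_mass n c k * indicator J k)) = ennreal (length_set_mass n c J)"
    unfolding length_set_mass_def
    using assms length_mass_nonneg[OF \<open>n \<ge> 2\<close> assms(4)]
    by (intro suminf_ennreal2 summable_length_set) auto
  then show ?thesis
    using emeasure_loops_of_length_in[OF assms(1,2) \<open>n \<ge> 2\<close> assms(4)] by simp
qed

locale killing_rates =
  fixes a :: real and c \<epsilon> :: "nat \<Rightarrow> real"
  assumes a_pos: "a > 0"
    and eps: "\<epsilon> \<longlonglongrightarrow> 0"
    and c_eq: "\<And>n. n \<ge> 2 \<Longrightarrow> c n = real n powr (- a + \<epsilon> n)"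
begin

lemma c_pos: "n \<ge> 2 \<Longrightarrow> c n > 0"
  by (simp add: c_eq)

text \<open>Below the exponent \<open>a\<close> the error term of \<open>length_set_mass_short_ge\<close> vanishes: half of the gap
  \<open>a - y\<close> absorbs \<open>\<epsilon> n\<close>, the other half gives the decay.\<close>

lemma c_powr_tendsto_0:
  assumes "y < a"
  shows "(\<lambda>n. c n * real n powr y) \<longlonglongrightarrow> 0"
proof (rule tendsto_sandwich)
  let ?d = "(a - y) / 2"
  have "\<forall>\<^sub>F n in sequentially. \<epsilon> n < ?d"
    using order_tendstoD(2)[OF eps, of ?d] assms by simp
  then show "\<forall>\<^sub>F n in sequentially. c n * real n powr y \<le> real n powr (- ?d)"
    using eventually_ge_at_top[of 2]
  proof eventually_elim
    case (elim n)
    have "c n * real n powr y = real n powr (- a + \<epsilon> n + y)"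
      using elim by (simp add: c_eq powr_add)
    also have "\<dots> \<le> real n powr (- ?d)"
      using elim by (intro powr_mono) (auto simp: field_simps)
    finally show ?case .
  qed
  show "\<forall>\<^sub>F n in sequentially. 0 \<le> c n * real n powr y"
    using eventually_ge_at_top[of 2] by eventually_elim (simp add: c_eq)
  show "(\<lambda>n. real n powr (- ?d)) \<longlonglongrightarrow> 0"
    using assms by (intro tendsto_neg_powr filterlim_real_sequentially) auto
qed simp

lemma ln_at_top: "filterlim (\<lambda>n. ln (real n)) at_top sequentially"
  by (rule filterlim_compose[OF ln_at_top filterlim_real_sequentially])

lemma log_total_tendsto: "(\<lambda>n. (ln (1 + 1 / c n) + 4) / ln (real n)) \<longlonglongrightarrow> a"
proof -
  have "c \<longlonglongrightarrow> 0"
  proof (rule Lim_transform_eventually[OF c_powr_tendsto_0[OF a_pos]])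
    show "\<forall>\<^sub>F n in sequentially. c n * real n powr 0 = c n"
      using eventually_ge_at_top[of 2] by eventually_elim simp
  qed
  then have "(\<lambda>n. ln (1 + c n) + 4) \<longlonglongrightarrow> ln (1 + 0) + 4"
    by (intro tendsto_intros) auto
  from tendsto_divide_0[OF this filterlim_at_top_imp_at_infinity[OF ln_at_top]]
  have "(\<lambda>n. (ln (1 + c n) + 4) / ln (real n)) \<longlonglongrightarrow> 0" .
  then have "(\<lambda>n. (ln (1 + c n) + 4) / ln (real n) + (a - \<epsilon> n)) \<longlonglongrightarrow> 0 + (a - 0)"
    by (intro tendsto_intros eps)
  then show ?thesis
  proof (rule Lim_transform_eventually[OF tendsto_eq_rhs])
    show "\<forall>\<^sub>F n in sequentially. (ln (1 + c n) + 4) / ln (real n) + (a - \<epsilon> n)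
            = (ln (1 + 1 / c n) + 4) / ln (real n)"
      using eventually_ge_at_top[of 2]
    proof eventually_elim
      case (elim n)
      have c: "c n > 0" and l: "ln (real n) > 0" using elim by (auto simp: c_pos)
      have "1 + 1 / c n = (1 + c n) / c n" using c by (simp add: field_simps)
      then have "ln (1 + 1 / c n) = ln (1 + c n) - ln (c n)" using c by (simp add: ln_div)
      also have "ln (c n) = (- a + \<epsilon> n) * ln (real n)"
        using elim by (simp add: c_eq ln_powr)
      finally show ?case using l by (simp add: field_simps)
    qed
  qed simp
qed

text \<open>The squeeze.  The lower bound comes from the short lengths alone, at exponents \<open>y\<close> below
  \<open>b\<close>; hence only the upper bound has to be supplied.  The whole
  logarithmic series serves for sets that reach beyond \<open>n powr a\<close>, the harmonic sum for the lengths
  up to \<open>n powr x\<close> with \<open>x \<le> a\<close>.\<close>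

lemma length_set_mass_tendsto:
  assumes b: "0 \<le> b" "b \<le> a"
    and lower: "\<And>n y. 0 \<le> y \<Longrightarrow> y < b \<Longrightarrow> short_lengths n y \<subseteq> J n"
    and upper: "\<forall>\<^sub>F n in sequentially. length_set_mass n (c n) (J n) / ln (real n) \<le> u n"
    and u: "u \<longlonglongrightarrow> b"
  shows "(\<lambda>n. length_set_mass n (c n) (J n) / ln (real n)) \<longlonglongrightarrow> b"
proof (rule order_tendstoI)
  fix l assume "l < b"
  show "\<forall>\<^sub>F n in sequentially. l < length_set_mass n (c n) (J n) / ln (real n)"
  proof (cases "l < 0")
    case True
    show ?thesis
      using eventually_ge_at_top[of 3]
    proof eventually_elim
      case (elim n)
      then have "0 \<le> length_set_mass n (c n) (J n) / ln (real n)"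
        by (intro divide_nonneg_nonneg length_set_mass_nonneg c_pos) auto
      then show ?case using True by linarith
    qed
  next
    case False
    \<comment> \<open>Strictly between \<open>l\<close> and \<open>b\<close>: at \<open>y = a\<close> the error \<open>c n * real n powr y\<close> need not be bounded.\<close>
    obtain y where y: "l < y" "y < b" using dense[OF \<open>l < b\<close>] by blast
    have "(\<lambda>n. c n * real n powr y + 4) \<longlonglongrightarrow> 0 + 4"
      using y b by (intro tendsto_intros c_powr_tendsto_0) auto
    from tendsto_divide_0[OF this filterlim_at_top_imp_at_infinity[OF ln_at_top]]
    have "(\<lambda>n. y - (c n * real n powr y + 4) / ln (real n)) \<longlonglongrightarrow> y - 0"
      by (intro tendsto_intros)
    then have "\<forall>\<^sub>F n in sequentially. l < y - (c n * real n powr y + 4) / ln (real n)"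
      using y by (intro order_tendstoD(1)) auto
    then show ?thesis
      using eventually_ge_at_top[of 3]
    proof eventually_elim
      case (elim n)
      have l: "ln (real n) > 0" and c: "c n > 0" using elim by (auto simp: c_pos)
      have "y * ln (real n) - c n * real n powr y - 4 \<le> length_set_mass n (c n) (short_lengths n y)"
        using False y elim c by (intro length_set_mass_short_ge) auto
      also have "\<dots> \<le> length_set_mass n (c n) (J n)"
        using False y elim c lower by (intro length_set_mass_mono) auto
      finally have "(y * ln (real n) - c n * real n powr y - 4) / ln (real n)
                      \<le> length_set_mass n (c n) (J n) / ln (real n)"
        using l by (intro divide_right_mono) auto
      then have "y - (c n * real n powr y + 4) / ln (real n)
                      \<le> length_set_mass n (c n) (J n) / ln (real n)"
        using l by (simp add: diff_divide_distrib add_divide_distrib)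
      then show ?case using elim by linarith
    qed
  qed
next
  fix r assume "b < r"
  from order_tendstoD(2)[OF u this] upper
  show "\<forall>\<^sub>F n in sequentially. length_set_mass n (c n) (J n) / ln (real n) < r"
    by eventually_elim simp
qed

lemma upper_log_total:
  "\<forall>\<^sub>F n in sequentially. length_set_mass n (c n) (J n) / ln (real n)
     \<le> (ln (1 + 1 / c n) + 4) / ln (real n)"
  using eventually_ge_at_top[of 3]
proof eventually_elim
  case (elim n)
  then show ?case
    using length_set_mass_approx[of n "c n" "J n"] log_set_sum_le[of "c n" "J n"] c_pos[of n]
    by (intro divide_right_mono) auto
qed

lemma total_mass_tendsto:
  "(\<lambda>n. length_set_mass n (c n) UNIV / ln (real n)) \<longlonglongrightarrow> a"
  using a_pos by (intro length_set_mass_tendsto[OF _ _ _ upper_log_total log_total_tendsto]) auto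

lemma short_mass_tendsto:
  "(\<lambda>n. length_set_mass n (c n) (short_lengths n x) / ln (real n)) \<longlonglongrightarrow> max 0 (min x a)"
proof -
  consider "x < 0" | "0 \<le> x" "x \<le> a" | "a < x" by linarith
  then show ?thesis
  proof cases
    case 1
    have empty: "short_lengths n x = {}" if "n \<ge> 3" for n
    proof -
      have "0 \<le> ln (real k) / ln (real n)" for k
        using that by (cases "k = 0") auto
      then show ?thesis using 1 unfolding short_lengths_def by (smt (verit) empty_Collect_eq)
    qed
    have "\<forall>\<^sub>F n in sequentially.
        0 = length_set_mass n (c n) (short_lengths n x) / ln (real n)"
      using eventually_ge_at_top[of 3] by eventually_elim (simp add: empty length_set_mass_def)
    from Lim_transform_eventually[OF tendsto_const this] show ?thesis using 1 by simp
  next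
    case 2
    have "(\<lambda>n. 5 / ln (real n)) \<longlonglongrightarrow> 0"
      by (intro tendsto_divide_0[OF tendsto_const] filterlim_at_top_imp_at_infinity ln_at_top)
    then have "(\<lambda>n. x + 5 / ln (real n)) \<longlonglongrightarrow> x + 0" by (intro tendsto_intros)
    then have u: "(\<lambda>n. x + 5 / ln (real n)) \<longlonglongrightarrow> x" by simp
    have "(\<lambda>n. length_set_mass n (c n) (short_lengths n x) / ln (real n)) \<longlonglongrightarrow> x"
    proof (rule length_set_mass_tendsto[OF 2 _ _ u])
      show "\<forall>\<^sub>F n in sequentially. length_set_mass n (c n) (short_lengths n x) / ln (real n)
              \<le> x + 5 / ln (real n)"
        using eventually_ge_at_top[of 3]
      proof eventually_elim
        case (elim n)
        then have "ln (real n) > 0" by simp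
        then show ?case
          using length_set_mass_short_le[of n "c n" x] 2 elim c_pos[of n] by (simp add: field_simps)
      qed
    qed (auto simp: short_lengths_def)
    then show ?thesis using 2 by simp
  next
    case 3
    then have "(\<lambda>n. length_set_mass n (c n) (short_lengths n x) / ln (real n)) \<longlonglongrightarrow> a"
      using a_pos
      by (intro length_set_mass_tendsto[OF _ _ _ upper_log_total log_total_tendsto])
         (auto simp: short_lengths_def)
    then show ?thesis using 3 a_pos by simp
  qed
qed

end

section \<open>Distribution functions\<close>

lemma cdf_uniform_measure:
  fixes a :: real
  assumes "a > 0"
  shows "cdf (uniform_measure lborel {0<..<a}) x = max 0 (min x a) / a"
proof -
  have "measure lborel ({0<..<a} \<inter> {..x}) = max 0 (min x a)"
  proof -
    consider "x \<le> 0" | "0 < x" "x < a" | "a \<le> x" by linarith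
    then show ?thesis
    proof cases
      case 1
      then have "{0<..<a} \<inter> {..x} = {}" by auto
      with 1 show ?thesis by simp
    next
      case 2
      then have "{0<..<a} \<inter> {..x} = {0<..x}" by auto
      with 2 show ?thesis by simp
    next
      case 3
      then have "{0<..<a} \<inter> {..x} = {0<..<a}" by auto
      with 3 assms show ?thesis by simp
    qed
  qed
  then show ?thesis
    using assms by (simp add: cdf_def measure_uniform_measure)
qed

lemma cdf_log_length:
  assumes V: "finite V" "card V = n" "n \<ge> 3" "c > 0"
    and pos: "length_set_mass n c UNIV > 0"
  shows "cdf (distr (normalized_loop_measure V (complete_graph_walk V) c) borel
             (\<lambda>l. ln (real (loop_length l)) / ln (real n))) x
       = length_set_mass n c (short_lengths n x) / length_set_mass n c UNIV"
proof -
  let ?\<mu> = "loop_measure V (complete_graph_walk V) c"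
  let ?\<nu> = "normalized_loop_measure V (complete_graph_walk V) c"
  let ?g = "\<lambda>l. ln (real (loop_length l)) / ln (real n)"
  have sp: "space ?\<mu> = loops V" "sets ?\<mu> = Pow (loops V)"
    by (simp_all add: loop_measure_def)
  have sn: "space ?\<nu> = loops V" "sets ?\<nu> = Pow (loops V)"
    by (simp_all add: normalized_loop_measure_def sp space_scale_measure)
  have tot: "emeasure ?\<mu> (space ?\<mu>) = ennreal (length_set_mass n c UNIV)"
    using emeasure_loops_eq_length_set_mass[OF V, of UNIV] by (simp add: sp)
  have "cdf (distr ?\<nu> borel ?g) x = measure ?\<nu> (?g -` {..x} \<inter> space ?\<nu>)"
    unfolding cdf_def by (rule measure_distr) (auto simp: measurable_def sn)
  also have "?g -` {..x} \<inter> space ?\<nu> = {l \<in> loops V. loop_length l \<in> short_lengths n x}"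
    by (auto simp: sn short_lengths_def)
  also have "measure ?\<nu> \<dots> = enn2real (inverse (ennreal (length_set_mass n c UNIV))
                * ennreal (length_set_mass n c (short_lengths n x)))"
    unfolding measure_def normalized_loop_measure_def tot
    by (simp add: emeasure_loops_eq_length_set_mass[OF V])
  also have "\<dots> = length_set_mass n c (short_lengths n x) / length_set_mass n c UNIV"
    using pos length_set_mass_nonneg[OF V(3,4)]
    by (simp add: inverse_ennreal enn2real_mult field_simps)
  finally show ?thesis .
qed

theorem theorem1p2:
  fixes a :: real and c :: "nat \<Rightarrow> real" and V :: "nat \<Rightarrow> 'v set"
  assumes "a > 0"
    and "\<And>n. n \<ge> 2 \<Longrightarrow> finite (V n) \<and> card (V n) = n"
    and "\<And>n. n \<ge> 2 \<Longrightarrow> c n > 0"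
    and "\<exists>\<epsilon> :: nat \<Rightarrow> real. \<epsilon> \<in> o(\<lambda>_. 1) \<and> (\<forall>n\<ge>2. c n = real n powr (- a + \<epsilon> n))"
  defines "\<mu> \<equiv> \<lambda>n. loop_measure (V n) (complete_graph_walk (V n)) (c n)"
    and "\<mu>bar \<equiv> \<lambda>n. normalized_loop_measure (V n) (complete_graph_walk (V n)) (c n)"
  shows "(\<lambda>n. measure (\<mu> n) (space (\<mu> n)) / ln (real n)) \<longlonglongrightarrow> a
    \<and> weak_conv_m
        (\<lambda>n. distr (\<mu>bar n) borel (\<lambda>l. ln (real (loop_length l)) / ln (real n)))
        (uniform_measure lborel {0<..<a})"
proof -
  obtain \<epsilon> :: "nat \<Rightarrow> real" where \<epsilon>: "\<epsilon> \<in> o(\<lambda>_. 1)" "\<And>n. n \<ge> 2 \<Longrightarrow> c n = real n powr (- a + \<epsilon> n)"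
    using assms(4) by auto
  interpret killing_rates a c \<epsilon>
    using assms(1) \<epsilon> by unfold_locales (auto dest: smalloD_tendsto)
  have V: "finite (V n)" "card (V n) = n" "c n > 0" if "n \<ge> 3" for n
    using assms(2,3) that by auto
  have mass: "measure (\<mu> n) (space (\<mu> n)) = length_set_mass n (c n) UNIV" if "n \<ge> 3" for n
  proof -
    have "space (\<mu> n) = {l \<in> loops (V n). loop_length l \<in> UNIV}"
      by (simp add: \<mu>_def loop_measure_def)
    then show ?thesis
      using emeasure_loops_eq_length_set_mass[OF V(1,2)[OF that] that V(3)[OF that], of UNIV]
        length_set_mass_nonneg[OF that V(3)[OF that]]
      by (simp add: measure_def \<mu>_def)
  qed
  have "(\<lambda>n. measure (\<mu> n) (space (\<mu> n)) / ln (real n)) \<longlonglongrightarrow> a"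
  proof (rule Lim_transform_eventually[OF total_mass_tendsto])
    show "\<forall>\<^sub>F n in sequentially. length_set_mass n (c n) UNIV / ln (real n)
            = measure (\<mu> n) (space (\<mu> n)) / ln (real n)"
      using eventually_ge_at_top[of 3] by eventually_elim (simp add: mass)
  qed
  moreover have "(\<lambda>n. cdf (distr (\<mu>bar n) borel (\<lambda>l. ln (real (loop_length l)) / ln (real n))) x)
      \<longlonglongrightarrow> cdf (uniform_measure lborel {0<..<a}) x" for x
  proof -
    \<comment> \<open>The scale \<open>ln n\<close> cancels in the quotient of the two limits.\<close>
    have "(\<lambda>n. (length_set_mass n (c n) (short_lengths n x) / ln (real n))
             / (length_set_mass n (c n) UNIV / ln (real n))) \<longlonglongrightarrow> max 0 (min x a) / a"
      using a_pos by (intro tendsto_divide short_mass_tendsto total_mass_tendsto) auto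
    moreover have "\<forall>\<^sub>F n in sequentially. 0 < length_set_mass n (c n) UNIV / ln (real n)"
      using order_tendstoD(1)[OF total_mass_tendsto a_pos] .
    then have "\<forall>\<^sub>F n in sequentially.
        (length_set_mass n (c n) (short_lengths n x) / ln (real n))
             / (length_set_mass n (c n) UNIV / ln (real n))
        = cdf (distr (\<mu>bar n) borel (\<lambda>l. ln (real (loop_length l)) / ln (real n))) x"
      using eventually_ge_at_top[of 3]
    proof eventually_elim
      case (elim n)
      then have l: "ln (real n) > 0" by simp
      with elim have "length_set_mass n (c n) UNIV > 0" by (simp add: zero_less_divide_iff)
      then show ?case
        using l V[of n] elim by (simp add: \<mu>bar_def cdf_log_length)
    qed
    ultimately show ?thesis
      unfolding cdf_uniform_measure[OF assms(1)] by (rule Lim_transform_eventually)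
  qed
  ultimately show ?thesis
    by (simp add: weak_conv_m_def weak_conv_def)
qed

end
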